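(* Let $x_i,g_i\in\mathbb R^d$ and $f_i\in\mathbb R$ for $i\in\mathcal I$. The set of observations $\{(x_i,g_i,f_i)\}_{i\in\mathcal I}$ is $\mathcal F_{0,L}$-interpolable if and only if, for all $\eta>0$, the observation data $$\Big(\big\{\big((\tfrac{x_i}{\eta},f_i),(\eta g_i,-1)\big)\big\}_{i\in\mathcal I},\ \emptyset\Big)$$ (boundary points $(\frac{x_i}\eta,f_i)\in\mathbb R^{d+1}$ with normal vectors $(\eta g_i,-1)\in\mathbb R^{d+1}$) is $\mathcal C_{0,\eta^2L,\infty}$-interpolable.
   Context: Functions. For a closed convex $f:\mathbb R^d\to\mathbb R\cup\{\infty\}$, $\partial f(x)=\{g: f(y)\ge f(x)+\langle g,y-x\rangle\ \forall y\}$ for $x\in\mathrm{dom}\,f$. $f$ is $L$-smooth if $f(y)\le f(x)+\langle g,y-x\rangle+\frac L2\|y-x\|^2$ for all $x,y\in\mathbb R^d$, $g\in\partial f(x)$; $f$ is $\mu$-strongly convex if $f(y)\ge f(x)+\langle g,y-x\rangle+\frac\mu2\|y-x\|^2$ for all such $x,y,g$. (Every convex $f$ is $0$-strongly convex and $\infty$-smooth.) $\mathcal F_{\mu,L}$ is the set of $\mu$-strongly convex, $L$-smooth (closed convex) functions; thus $\mathcal F_{0,L}$ consists of the closed convex $L$-smooth functions. $\{(x_i,g_i,f_i)\}_{i\in\mathcal I}$ is $\mathcal F_{\mu,L}$-interpolable if there is $f\in\mathcal F_{\mu,L}$ with $g_i\in\partial f(x_i)$ and $f(x_i)=f_i$ for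 all $i\in\mathcal I$. Sets. $B(x,r)$ is the closed Euclidean ball. For a nonempty closed convex set $C$, $N_C(z)=\{v:\langle v,x-z\rangle\le0\ \forall x\in C\}$ for $z\in\mathrm{bdry}\,C$. $C$ is $\beta$-smooth if $B(z-\frac1\beta n,\frac1\beta)\subseteq C$ for every $z\in\mathrm{bdry}\,C$ and every unit vector $n\in N_C(z)$ (every closed convex set is $\infty$-smooth; limiting case: the only $0$-smooth sets are halfspaces). $\mathcal C_{0,\beta,\infty}$ is the set of nonempty closed convex $\beta$-smooth sets (no strong convexity or diameter requirement). Data $(\{(z_i,v_i)\}_{i\in\mathcal I},\emptyset)$, consisting only of points with normal vectors, is $\mathcal C_{0,\beta,\infty}$-interpolable if there exists $C\in\mathcal C_{0,\beta,\infty}$ with $z_i\in C$ and $v_i\in N_C(z_i)$ for all $i\in\mathcal I$. *)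

theory Defs
  imports "HOL-Analysis.Analysis"
begin

text \<open>
  Functions \<open>\<real>\<^sup>d \<rightarrow> \<real> \<union> {\<infinity>}\<close> are \<open>ereal\<close>-valued functions that avoid \<open>-\<infinity>\<close>; smoothness
  parameters range over \<open>[0, \<infinity>]\<close> and are also \<open>ereal\<close>s. Products \<open>'a \<times> real\<close> carry the
  Euclidean structure of the direct sum, so they stand for \<open>\<real>\<^sup>d\<^sup>+\<^sup>1\<close>.
\<close>

definition epi :: "('a \<Rightarrow> ereal) \<Rightarrow> ('a \<times> real) set" where
  "epi f = {(x, t). f x \<le> ereal t}"

text \<open>As usual in convex analysis, ``closed'' means that the epigraph is closed.\<close>

definition closed_convex_fun :: "('a::euclidean_space \<Rightarrow> ereal) \<Rightarrow> bool" where
  "closed_convex_fun f \<longleftrightarrow> (\<forall>x. f x \<noteq> -\<infinity>) \<and> closed (epi f) \<and> convex (epi f)"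

text \<open>The subdifferential is empty outside the domain of \<open>f\<close>.\<close>

definition subdiff :: "('a::euclidean_space \<Rightarrow> ereal) \<Rightarrow> 'a \<Rightarrow> 'a set" where
  "subdiff f x = {g. f x < \<infinity> \<and> (\<forall>y. f y \<ge> f x + ereal (g \<bullet> (y - x)))}"

text \<open>
  For \<open>L = \<infinity>\<close> the condition is void: the last summand is \<open>\<infinity>\<close> if \<open>y \<noteq> x\<close>, and
  \<open>\<infinity> * 0 = 0\<close> in \<open>ereal\<close> if \<open>y = x\<close>.
\<close>

definition smooth_fun :: "ereal \<Rightarrow> ('a::euclidean_space \<Rightarrow> ereal) \<Rightarrow> bool" where
  "smooth_fun L f \<longleftrightarrow> (\<forall>x y. \<forall>g\<in>subdiff f x.
     f y \<le> f x + ereal (g \<bullet> (y - x)) + L / 2 * ereal ((norm (y - x))\<^sup>2))"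

definition strongly_convex_fun :: "real \<Rightarrow> ('a::euclidean_space \<Rightarrow> ereal) \<Rightarrow> bool" where
  "strongly_convex_fun \<mu> f \<longleftrightarrow> (\<forall>x y. \<forall>g\<in>subdiff f x.
     f y \<ge> f x + ereal (g \<bullet> (y - x)) + ereal (\<mu> / 2 * (norm (y - x))\<^sup>2))"

definition fun_class :: "real \<Rightarrow> ereal \<Rightarrow> ('a::euclidean_space \<Rightarrow> ereal) set" where
  "fun_class \<mu> L = {f. closed_convex_fun f \<and> strongly_convex_fun \<mu> f \<and> smooth_fun L f}"

definition fun_interpolable ::
  "real \<Rightarrow> ereal \<Rightarrow> 'i set \<Rightarrow> ('i \<Rightarrow> 'a::euclidean_space \<times> 'a \<times> real) \<Rightarrow> bool" where
  "fun_interpolable \<mu> L I obs \<longleftrightarrow> (\<exists>f\<in>fun_class \<mu> L. \<forall>i\<in>I.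
     case obs i of (x, g, v) \<Rightarrow> g \<in> subdiff f x \<and> f x = ereal v)"

text \<open>Only meant for \<open>z \<in> frontier C\<close>; all uses below have this guard.\<close>

definition normal_cone :: "'a::euclidean_space set \<Rightarrow> 'a \<Rightarrow> 'a set" where
  "normal_cone C z = {v. \<forall>x\<in>C. v \<bullet> (x - z) \<le> 0}"

definition is_halfspace :: "'a::euclidean_space set \<Rightarrow> bool" where
  "is_halfspace C \<longleftrightarrow> (\<exists>a b. a \<noteq> 0 \<and> C = {x. a \<bullet> x \<le> b})"

text \<open>
  The case \<open>\<beta> = 0\<close>, where the radius \<open>1 / \<beta>\<close> is infinite, is fixed by convention: exactly the
  halfspaces are \<open>0\<close>-smooth. For \<open>\<beta> = \<infinity>\<close> the radius is \<open>0\<close> and the condition is void for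
  closed sets.
\<close>

definition smooth_set :: "ereal \<Rightarrow> 'a::euclidean_space set \<Rightarrow> bool" where
  "smooth_set \<beta> C \<longleftrightarrow>
     (if \<beta> = 0 then is_halfspace C
      else \<forall>z\<in>frontier C. \<forall>n\<in>normal_cone C z. norm n = 1 \<longrightarrow>
        (let r = real_of_ereal (1 / \<beta>) in cball (z - r *\<^sub>R n) r \<subseteq> C))"

text \<open>
  The class \<open>\<C>\<^bsub>0,\<beta>,\<infinity>\<^esub>\<close>: smoothness \<open>\<beta>\<close>, with neither a strong convexity nor a diameter
  requirement.
\<close>

definition smooth_set_class :: "ereal \<Rightarrow> 'a::euclidean_space set set" where
  "smooth_set_class \<beta> = {C. C \<noteq> {} \<and> closed C \<and> convex C \<and> smooth_set \<beta> C}"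

text \<open>Interpolability of data consisting only of boundary points with normal vectors.\<close>

definition set_interpolable ::
  "ereal \<Rightarrow> 'i set \<Rightarrow> ('i \<Rightarrow> 'a::euclidean_space \<times> 'a) \<Rightarrow> bool" where
  "set_interpolable \<beta> I obs \<longleftrightarrow> (\<exists>C\<in>smooth_set_class \<beta>. \<forall>i\<in>I.
     case obs i of (z, v) \<Rightarrow> z \<in> C \<and> z \<in> frontier C \<and> v \<in> normal_cone C z)"

end

theory Submission
  imports Defs
begin

text \<open>
  Write \<open>\<ell>\<^sub>j(u) = f\<^sub>j + g\<^sub>j \<bullet> (u - x\<^sub>j)\<close> for the prescribed tangents and
  \<open>q\<^sub>i(u) = \<ell>\<^sub>i(u) + L/2 |u - x\<^sub>i|\<^sup>2\<close> for the upper bounds that \<open>L\<close>-smoothness puts on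
  an interpolant. Both sides of the equivalence amount to the single condition that
  \<open>\<ell>\<^sub>j \<le> q\<^sub>i\<close> everywhere, for all \<open>i\<close> and \<open>j\<close>. Stating the condition through
  \<open>\<ell>\<^sub>j\<close> and \<open>q\<^sub>i\<close>, rather than through the usual inequality with
  \<open>|g\<^sub>i - g\<^sub>j|\<^sup>2 / (2 L)\<close>, makes it meaningful for all \<open>L\<close>, including \<open>0\<close> and
  \<open>\<infinity>\<close>.

  From functions to sets: rescaling the argument by \<open>\<eta>\<close> turns an \<open>L\<close>-smooth function into an
  \<open>\<eta>\<^sup>2 L\<close>-smooth one, and the epigraph of a \<open>\<beta>\<close>-smooth convex function is a
  \<open>\<beta>\<close>-smooth set: a ball of radius \<open>1 / \<beta>\<close> touching the graph lies above the paraboloid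
  of curvature \<open>\<beta>\<close> with the same tangent, which in turn lies above the graph
  (\<open>scaled_epi_contains_ball\<close>).

  From sets to functions: as \<open>\<eta> \<rightarrow> 0\<close>, the tangent ball of radius \<open>1 / (\<eta>\<^sup>2 L)\<close> at
  the \<open>i\<close>-th point, stretched horizontally by \<open>\<eta>\<close>, fills out the region above the graph of
  \<open>q\<^sub>i\<close> (\<open>ball_contains_near_paraboloid\<close>). The ball is contained in the set, which lies
  above the \<open>j\<close>-th tangent hyperplane; in the limit \<open>\<ell>\<^sub>j \<le> q\<^sub>i\<close>
  (\<open>tangents_below_paraboloids\<close>). Each \<open>\<eta>\<close> has its own set, but only this inequality is
  taken to the limit, so no convergence of the sets is involved.

  Finally, given \<open>\<ell>\<^sub>j \<le> q\<^sub>i\<close>, the supremum of all affine functions below every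
  \<open>q\<^sub>i\<close> interpolates (\<open>fun_interpolableI\<close>). It is the closed convex hull of
  \<open>inf\<^sub>i q\<^sub>i\<close>; convexity and interpolation are immediate, and smoothness is inherited from
  the \<open>q\<^sub>i\<close> (\<open>smooth_fun_affine_sup_minorants\<close>).
\<close>

lemma ereal_half: "ereal l / 2 = ereal (l / 2)" "(\<infinity>::ereal) / 2 = \<infinity>"
  using ereal_divide[of l 2] by (simp_all add: numeral_eq_ereal)

section \<open>Functions with prescribed tangents and quadratic upper bounds\<close>

definition affine_sup :: "('a::euclidean_space \<times> real) set \<Rightarrow> 'a \<Rightarrow> ereal" where
  "affine_sup M y = (SUP (a, b)\<in>M. ereal (a \<bullet> y + b))"

lemma affine_sup_upper: "(a, b) \<in> M \<Longrightarrow> ereal (a \<bullet> y + b) \<le> affine_sup M y"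
  unfolding affine_sup_def by (rule SUP_upper2[of "(a, b)"]) auto

lemma affine_sup_least:
  "(\<And>a b. (a, b) \<in> M \<Longrightarrow> ereal (a \<bullet> y + b) \<le> c) \<Longrightarrow> affine_sup M y \<le> c"
  unfolding affine_sup_def by (rule SUP_least) auto

lemma closed_convex_fun_affine_sup:
  assumes "M \<noteq> {}"
  shows "closed_convex_fun (affine_sup M)"
proof -
  obtain a b where ab: "(a, b) \<in> M"
    using assms by auto
  have "affine_sup M y \<noteq> -\<infinity>" for y
    using affine_sup_upper[OF ab, of y] by auto
  moreover have "epi (affine_sup M) = (\<Inter>(a, b)\<in>M. {z. (a, -1::real) \<bullet> z \<le> - b})"
  proof -
    have "affine_sup M y \<le> ereal t \<longleftrightarrow> (\<forall>(a, b)\<in>M. a \<bullet> y + b \<le> t)" for y t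
      unfolding affine_sup_def SUP_le_iff by auto
    then show ?thesis
      unfolding epi_def by (force simp: inner_prod_def)
  qed
  ultimately show ?thesis
    unfolding closed_convex_fun_def
    by (auto intro!: closed_INT convex_INT closed_halfspace_le convex_halfspace_le split: prod.splits)
qed

text \<open>The Jensen gap of \<open>|\<cdot>|\<^sup>2\<close> is independent of the base point \<open>m\<close>.\<close>

lemma norm_sq_convex_combination:
  fixes m w :: "'a::real_inner"
  shows "t * (norm (m + (1 - t) *\<^sub>R w))\<^sup>2 + (1 - t) * (norm (m - t *\<^sub>R w))\<^sup>2
    = (norm m)\<^sup>2 + t * (1 - t) * (norm w)\<^sup>2"
  unfolding power2_norm_eq_inner
  by (simp add: inner_simps inner_commute algebra_simps power2_eq_square)

text \<open>
  The quadratic upper bound need only be checked on each affine minorant \<open>A\<close> of the \<open>q\<^sub>i\<close>.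
  A subgradient at \<open>p\<close> gives a second minorant \<open>\<ell>\<close>, exact at \<open>p\<close>. Average a forward
  shift of \<open>A\<close> with a backward shift of \<open>\<ell>\<close>, the shifts being balanced so as to have mean
  zero. The same average of \<open>q\<^sub>i\<close> is \<open>q\<^sub>i\<close> plus an explicit constant, which depends
  neither on \<open>i\<close> nor on the point; so the averaged function minus this constant is again a
  minorant, and comparing it at \<open>p\<close> with the supremum bounds \<open>A\<close> at the shifted point, up to a
  factor that tends to \<open>1\<close> as the weight of \<open>\<ell>\<close> does.
\<close>

lemma smooth_fun_affine_sup_minorants:
  fixes x g :: "'i \<Rightarrow> 'a::euclidean_space"
  assumes M: "M = {(a, b). \<forall>i\<in>I. \<forall>u.
      a \<bullet> u + b \<le> f i + g i \<bullet> (u - x i) + l / 2 * (norm (u - x i))\<^sup>2}"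
    and "M \<noteq> {}"
  shows "smooth_fun (ereal l) (affine_sup M)"
  unfolding smooth_fun_def
proof (intro allI ballI)
  fix p y :: 'a and k
  assume k: "k \<in> subdiff (affine_sup M) p"
  let ?q = "\<lambda>i u. f i + g i \<bullet> (u - x i) + l / 2 * (norm (u - x i))\<^sup>2"
  have "affine_sup M p \<noteq> -\<infinity>"
    using closed_convex_fun_affine_sup[OF \<open>M \<noteq> {}\<close>] by (auto simp: closed_convex_fun_def)
  then obtain c where c: "affine_sup M p = ereal c"
    using k unfolding subdiff_def by (cases "affine_sup M p") auto
  have sup_le: "affine_sup M u \<le> ereal (?q i u)" if "i \<in> I" for i u
    by (rule affine_sup_least) (use that M in auto)
  have tangent: "c + k \<bullet> (u - p) \<le> ?q i u" if "i \<in> I" for i u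
  proof -
    have "ereal (c + k \<bullet> (u - p)) \<le> affine_sup M u"
      using k c unfolding subdiff_def by auto
    also have "\<dots> \<le> ereal (?q i u)"
      by (rule sup_le[OF that])
    finally show ?thesis by simp
  qed
  define v where "v = y - p"
  have "a \<bullet> y + b \<le> c + k \<bullet> v + l / 2 * (norm v)\<^sup>2" if ab: "(a, b) \<in> M" for a b
  proof -
    have "s * (a \<bullet> y + b - c - k \<bullet> v) \<le> l / 2 * (norm v)\<^sup>2" if s: "0 < s" "s < 1" for s
    proof -
      define t where "t = 1 - s"
      define w where "w = v /\<^sub>R s"
      have v: "v = (1 - t) *\<^sub>R w" and t: "0 < t" "t < 1"
        using s by (auto simp: t_def w_def)
      \<comment> \<open>The affine function \<open>u \<mapsto> t (a \<bullet> (u + (1 - t) w) + b)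
        + (1 - t) (c + k \<bullet> (u - t w - p)) - l/2 t (1 - t) |w|\<^sup>2\<close> is a minorant again.\<close>
      define a' where "a' = t *\<^sub>R a + (1 - t) *\<^sub>R k"
      define b' where "b' = t * (a \<bullet> v + b) + (1 - t) * (c - k \<bullet> p - t * (k \<bullet> w))
        - l / 2 * (t * (1 - t) * (norm w)\<^sup>2)"
      have "a' \<bullet> u + b' \<le> ?q i u" if "i \<in> I" for i u
      proof -
        have "a \<bullet> (u + v) + b \<le> ?q i (u + v)"
          using ab that unfolding M by auto
        moreover have "c + k \<bullet> (u - t *\<^sub>R w - p) \<le> ?q i (u - t *\<^sub>R w)"
          by (rule tangent[OF that])
        ultimately have "t * (a \<bullet> (u + v) + b) + (1 - t) * (c + k \<bullet> (u - t *\<^sub>R w - p))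
            \<le> t * ?q i (u + v) + (1 - t) * ?q i (u - t *\<^sub>R w)"
          using t by (intro add_mono[OF mult_left_mono mult_left_mono]) auto
        also have "\<dots> = ?q i u + l / 2 * (t * (1 - t) * (norm w)\<^sup>2)"
        proof -
          define m where "m = u - x i"
          have m: "u + v - x i = m + (1 - t) *\<^sub>R w" "u - t *\<^sub>R w - x i = m - t *\<^sub>R w"
            by (auto simp: v m_def)
          have split: "t * (f i + g i \<bullet> (m + (1 - t) *\<^sub>R w) + l / 2 * P)
              + (1 - t) * (f i + g i \<bullet> (m - t *\<^sub>R w) + l / 2 * Q)
            = f i + g i \<bullet> m + l / 2 * (t * P + (1 - t) * Q)" for P Q
            by (simp add: inner_simps field_simps)
          then show ?thesis
            unfolding m split norm_sq_convex_combination by (simp add: m_def distrib_left)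
        qed
        finally show ?thesis
          unfolding a'_def b'_def by (simp add: inner_simps algebra_simps)
      qed
      then have "(a', b') \<in> M"
        unfolding M by auto
      from affine_sup_upper[OF this, of p] have "a' \<bullet> p + b' \<le> c"
        by (simp add: c)
      moreover have "y = p + v"
        by (simp add: v_def)
      ultimately have "t * (a \<bullet> y + b - c) - t * (1 - t) * (k \<bullet> w)
          \<le> l / 2 * (t * (1 - t) * (norm w)\<^sup>2)"
        unfolding a'_def b'_def by (simp add: inner_simps algebra_simps)
      then have "t * (a \<bullet> y + b - c - (1 - t) * (k \<bullet> w))
          \<le> t * (l / 2 * ((1 - t) * (norm w)\<^sup>2))"
        by (simp add: algebra_simps)
      then have "a \<bullet> y + b - c - k \<bullet> v \<le> l / 2 * (s * (norm w)\<^sup>2)"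
        using t by (simp add: v t_def)
      then have "s * (a \<bullet> y + b - c - k \<bullet> v) \<le> s * (l / 2 * (s * (norm w)\<^sup>2))"
        using s by simp
      also have "\<dots> = l / 2 * (norm v)\<^sup>2"
        using s by (simp add: w_def power2_eq_square field_simps)
      finally show ?thesis .
    qed
    from field_le_mult_one_interval[OF this] show ?thesis by simp
  qed
  then have "affine_sup M y \<le> ereal (c + k \<bullet> v + l / 2 * (norm v)\<^sup>2)"
    by (intro affine_sup_least) simp
  then show "affine_sup M y \<le> affine_sup M p + ereal (k \<bullet> (y - p))
      + ereal l / 2 * ereal ((norm (y - p))\<^sup>2)"
    by (simp add: c v_def ereal_half)
qed

text \<open>
  The supremum of the common affine minorants is at least \<open>\<ell>\<^sub>j\<close>, since \<open>\<ell>\<^sub>j\<close> is one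
  of them, and it is at most \<open>q\<^sub>j\<close>; at \<open>x\<^sub>j\<close> the two bounds agree. For empty \<open>I\<close> it
  is constantly \<open>\<infinity>\<close>.
\<close>

lemma fun_interpolableI:
  fixes x g :: "'i \<Rightarrow> 'a::euclidean_space"
  assumes "0 \<le> L"
    and tangents: "\<And>i j u. i \<in> I \<Longrightarrow> j \<in> I \<Longrightarrow> ereal (f j + g j \<bullet> (u - x j))
      \<le> ereal (f i + g i \<bullet> (u - x i)) + L / 2 * ereal ((norm (u - x i))\<^sup>2)"
  shows "fun_interpolable 0 L I (\<lambda>i. (x i, g i, f i))"
proof -
  define M where "M = {(a, b). \<forall>i\<in>I. \<forall>u. ereal (a \<bullet> u + b)
      \<le> ereal (f i + g i \<bullet> (u - x i)) + L / 2 * ereal ((norm (u - x i))\<^sup>2)}"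
  let ?h = "affine_sup M"
  have mem: "(g j, f j - g j \<bullet> x j) \<in> M" if "j \<in> I" for j
    using tangents[OF _ that] unfolding M_def by (simp add: inner_diff_right algebra_simps)
  have "M \<noteq> {}"
  proof (cases "I = {}")
    case True
    then show ?thesis by (auto simp: M_def)
  next
    case False
    then show ?thesis using mem by blast
  qed
  have "smooth_fun L ?h"
  proof (cases L)
    case (real l)
    have "M = {(a, b). \<forall>i\<in>I. \<forall>u.
        a \<bullet> u + b \<le> f i + g i \<bullet> (u - x i) + l / 2 * (norm (u - x i))\<^sup>2}"
      unfolding M_def real by (simp add: ereal_half)
    then show ?thesis
      unfolding real using \<open>M \<noteq> {}\<close> by (rule smooth_fun_affine_sup_minorants)
  next
    case PInf
    have "?h y \<le> ?h p + ereal (k \<bullet> (y - p)) + \<infinity> / 2 * ereal ((norm (y - p))\<^sup>2)" for p y k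
      by (cases "y = p") (simp_all add: ereal_half flip: zero_ereal_def)
    then show ?thesis
      unfolding PInf smooth_fun_def by blast
  qed (use assms in auto)
  moreover have "strongly_convex_fun 0 ?h"
    unfolding strongly_convex_fun_def subdiff_def by (auto simp flip: zero_ereal_def)
  ultimately have "?h \<in> fun_class 0 L"
    unfolding fun_class_def using closed_convex_fun_affine_sup[OF \<open>M \<noteq> {}\<close>] by simp
  moreover have "g i \<in> subdiff ?h (x i) \<and> ?h (x i) = ereal (f i)" if "i \<in> I" for i
  proof -
    have lower: "ereal (f i + g i \<bullet> (u - x i)) \<le> ?h u" for u
      using affine_sup_upper[OF mem[OF that], of u] by (simp add: inner_diff_right algebra_simps)
    have "?h (x i) \<le> ereal (f i)"
    proof (rule affine_sup_least)
      fix a b assume "(a, b) \<in> M"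
      then have "ereal (a \<bullet> x i + b) \<le> ereal (f i + g i \<bullet> (x i - x i))
          + L / 2 * ereal ((norm (x i - x i))\<^sup>2)"
        using that unfolding M_def by blast
      then show "ereal (a \<bullet> x i + b) \<le> ereal (f i)"
        by (simp flip: zero_ereal_def)
    qed
    then have "?h (x i) = ereal (f i)"
      using lower[of "x i"] by (intro antisym) auto
    then show ?thesis
      using lower unfolding subdiff_def by auto
  qed
  ultimately show ?thesis
    unfolding fun_interpolable_def by (intro bexI[of _ ?h]) auto
qed

section \<open>Balls tangent at a point with given normal\<close>

lemma mem_tangent_cball_iff:
  fixes z w n :: "'a::real_inner"
  assumes "norm n = 1" "r \<ge> 0"
  shows "z + w \<in> cball (z - r *\<^sub>R n) r \<longleftrightarrow> w \<bullet> w + 2 * r * (n \<bullet> w) \<le> 0"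
proof -
  have "dist (z - r *\<^sub>R n) (z + w) = norm (w + r *\<^sub>R n)"
    unfolding dist_norm by (subst norm_minus_commute) (simp add: algebra_simps)
  then have "z + w \<in> cball (z - r *\<^sub>R n) r \<longleftrightarrow> (norm (w + r *\<^sub>R n))\<^sup>2 \<le> r\<^sup>2"
    using assms by (simp add: power_mono_iff)
  also have "(norm (w + r *\<^sub>R n))\<^sup>2 = w \<bullet> w + 2 * r * (n \<bullet> w) + r\<^sup>2 * (n \<bullet> n)"
    unfolding power2_norm_eq_inner
    by (simp add: inner_simps inner_commute power2_eq_square algebra_simps)
  also have "n \<bullet> n = 1"
    using assms(1) by (simp add: norm_eq_1)
  finally show ?thesis by simp
qed

section \<open>From smooth sets to functions\<close>

text \<open>
  At a point of a halfspace, every normal vector is a multiple of the normal of the bounding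
  hyperplane. A direction orthogonal to a nonzero one therefore stays in the halfspace.
\<close>

lemma halfspace_contains_orthogonal_of_normal:
  fixes v w :: "'a::euclidean_space"
  assumes C: "C = {z. a \<bullet> z \<le> b}" "a \<noteq> 0"
    and "z \<in> C" "v \<in> normal_cone C z" "v \<noteq> 0" "v \<bullet> w = 0"
  shows "z + w \<in> C"
proof -
  define p where "p = v - ((v \<bullet> a) / (a \<bullet> a)) *\<^sub>R a"
  have ap: "a \<bullet> p = 0"
    using C by (simp add: p_def inner_simps inner_commute)
  then have "z + p \<in> C"
    using assms by (simp add: inner_simps)
  then have "v \<bullet> p \<le> 0"
    using assms by (auto simp: normal_cone_def)
  then have "p \<bullet> p \<le> 0"
    using ap by (subst (1) p_def) (simp add: inner_simps)
  then have "p = 0"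
    by (metis inner_gt_zero_iff not_less)
  then have v: "v = ((v \<bullet> a) / (a \<bullet> a)) *\<^sub>R a"
    by (simp add: p_def)
  then have "(v \<bullet> a) / (a \<bullet> a) \<noteq> 0"
    using \<open>v \<noteq> 0\<close> by auto
  moreover have "((v \<bullet> a) / (a \<bullet> a)) * (a \<bullet> w) = 0"
    using \<open>v \<bullet> w = 0\<close> by (subst (asm) v) simp
  ultimately have "a \<bullet> w = 0"
    by simp
  then show ?thesis
    using assms by (simp add: inner_simps)
qed

text \<open>
  With \<open>s = 1\<close> and without the term in \<open>\<tau>\<^sup>2\<close>, the hypothesis on \<open>\<tau>\<close> would say that
  the point lies above the paraboloid of curvature \<open>l\<close> with slope \<open>g\<close> at \<open>p\<close>. Both
  corrections vanish as \<open>\<eta> \<rightarrow> 0\<close>.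
\<close>

lemma ball_contains_near_paraboloid:
  fixes p g d :: "'a::euclidean_space"
  assumes "0 < \<eta>" "0 < l"
    and s: "s = sqrt (1 + \<eta>\<^sup>2 * (norm g)\<^sup>2)"
    and r: "r = 1 / (\<eta>\<^sup>2 * l)"
    and \<tau>: "g \<bullet> d + s * l / 2 * (norm d)\<^sup>2 + s * \<eta>\<^sup>2 * l / 2 * \<tau>\<^sup>2 \<le> \<tau>"
  shows "((p + d) /\<^sub>R \<eta>, c + \<tau>) \<in>
    cball ((p /\<^sub>R \<eta>, c) - r *\<^sub>R ((\<eta> *\<^sub>R g, -1) /\<^sub>R s)) r"
proof -
  define n where "n = (\<eta> *\<^sub>R g, -1::real) /\<^sub>R s"
  define w where "w = (d /\<^sub>R \<eta>, \<tau>)"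
  have s_norm: "s = norm (\<eta> *\<^sub>R g, -1::real)"
    by (simp add: s norm_prod_def power_mult_distrib add.commute)
  then have "s > 0"
    by (simp add: zero_prod_def)
  have "r > 0"
    using assms(1,2) by (simp add: r)
  have n: "norm n = 1"
    using \<open>s > 0\<close> s_norm by (simp add: n_def del: scaleR_Pair)
  have "w \<bullet> w + 2 * r * (n \<bullet> w) = 2 * r / s *
      (g \<bullet> d + s * l / 2 * (norm d)\<^sup>2 + s * \<eta>\<^sup>2 * l / 2 * \<tau>\<^sup>2 - \<tau>)"
    using assms(1,2) \<open>s > 0\<close> unfolding r n_def w_def power2_norm_eq_inner
    by (simp add: inner_prod_def inner_commute power2_eq_square field_simps)
  also have "\<dots> \<le> 0"
    using \<tau> \<open>r > 0\<close> \<open>s > 0\<close> by (intro mult_nonneg_nonpos) auto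
  finally have "(p /\<^sub>R \<eta>, c) + w \<in> cball ((p /\<^sub>R \<eta>, c) - r *\<^sub>R n) r"
    using n \<open>r > 0\<close> by (simp only: mem_tangent_cball_iff less_imp_le)
  then show ?thesis
    unfolding n_def w_def by (simp add: scaleR_add_right)
qed

text \<open>
  For \<open>L = \<infinity>\<close> and for \<open>L = 0\<close>, \<open>\<eta> = 1\<close> is enough; for the other values of \<open>L\<close> the
  tangent balls are used for arbitrarily small \<open>\<eta>\<close>.
\<close>

lemma tangents_below_paraboloids:
  fixes x g :: "'i \<Rightarrow> 'a::euclidean_space"
  assumes "0 \<le> L" and ij: "i \<in> I" "j \<in> I"
    and sets: "\<And>\<eta>. \<eta> > 0 \<Longrightarrow> set_interpolable (ereal (\<eta>\<^sup>2) * L) I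
        (\<lambda>i. ((x i /\<^sub>R \<eta>, f i), (\<eta> *\<^sub>R g i, -1)))"
  shows "ereal (f j + g j \<bullet> (u - x j))
      \<le> ereal (f i + g i \<bullet> (u - x i)) + L / 2 * ereal ((norm (u - x i))\<^sup>2)"
proof -
  have below: "f j + g j \<bullet> (w - x j) \<le> t"
    if "\<eta> > 0" "(w /\<^sub>R \<eta>, t) \<in> C" "(\<eta> *\<^sub>R g j, -1) \<in> normal_cone C (x j /\<^sub>R \<eta>, f j)"
    for \<eta> w t C
  proof -
    have "(\<eta> *\<^sub>R g j, -1) \<bullet> ((w /\<^sub>R \<eta>, t) - (x j /\<^sub>R \<eta>, f j)) \<le> 0"
      using that unfolding normal_cone_def by blast
    moreover have "w /\<^sub>R \<eta> - x j /\<^sub>R \<eta> = (w - x j) /\<^sub>R \<eta>"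
      by (simp add: scaleR_diff_right)
    ultimately show ?thesis
      using \<open>\<eta> > 0\<close> by (simp add: inner_prod_def inverse_eq_divide)
  qed
  define d where "d = u - x i"
  show ?thesis
  proof (cases L)
    case PInf
    show ?thesis
    proof (cases "u = x i")
      case True
      obtain C where C: "(x i /\<^sub>R 1, f i) \<in> C" "(1 *\<^sub>R g j, -1) \<in> normal_cone C (x j /\<^sub>R 1, f j)"
        using sets[of 1] ij unfolding set_interpolable_def by auto
      from below[OF _ C] True show ?thesis
        by (simp flip: zero_ereal_def)
    qed (simp add: PInf ereal_half)
  next
    case (real l)
    show ?thesis
    proof (cases "l = 0")
      case True
      then have "ereal (1\<^sup>2) * L = 0"
        by (simp add: real)
      then obtain C where C: "C \<in> smooth_set_class 0"
        "(x i, f i) \<in> C" "(g i, -1) \<in> normal_cone C (x i, f i)"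
        "(1 *\<^sub>R g j, -1) \<in> normal_cone C (x j /\<^sub>R 1, f j)"
        using sets[of 1] ij unfolding set_interpolable_def by auto
      obtain a b where ab: "C = {z. a \<bullet> z \<le> b}" "a \<noteq> 0"
        using C(1) unfolding smooth_set_class_def smooth_set_def is_halfspace_def by auto
      have "(x i, f i) + (d, g i \<bullet> d) \<in> C"
        by (rule halfspace_contains_orthogonal_of_normal[OF ab C(2,3)])
          (auto simp: inner_prod_def zero_prod_def)
      then have "(u /\<^sub>R 1, f i + g i \<bullet> d) \<in> C"
        by (simp add: d_def)
      from below[OF _ this C(4)] show ?thesis
        by (simp add: d_def real True flip: zero_ereal_def)
    next
      case False
      then have "l > 0"
        using assms(1) real by simp
      have "f j + g j \<bullet> (u - x j) \<le> f i + g i \<bullet> d + l / 2 * (norm d)\<^sup>2 + e" if "e > 0" for e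
      proof -
        \<comment> \<open>Raising the paraboloid by \<open>e\<close> leaves room for the corrections that make the ball
          differ from the region above it.\<close>
        define \<tau> where "\<tau> = g i \<bullet> d + l / 2 * (norm d)\<^sup>2 + e"
        define s where "s = (\<lambda>\<eta>. sqrt (1 + \<eta>\<^sup>2 * (norm (g i))\<^sup>2))"
        have "((\<lambda>\<eta>. g i \<bullet> d + s \<eta> * l / 2 * (norm d)\<^sup>2 + s \<eta> * \<eta>\<^sup>2 * l / 2 * \<tau>\<^sup>2)
            \<longlongrightarrow> g i \<bullet> d + sqrt (1 + 0\<^sup>2 * (norm (g i))\<^sup>2) * l / 2 * (norm d)\<^sup>2
              + sqrt (1 + 0\<^sup>2 * (norm (g i))\<^sup>2) * 0\<^sup>2 * l / 2 * \<tau>\<^sup>2) (at_right 0)"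
          unfolding s_def by (intro tendsto_intros) auto
        then have "\<forall>\<^sub>F \<eta> in at_right 0.
            g i \<bullet> d + s \<eta> * l / 2 * (norm d)\<^sup>2 + s \<eta> * \<eta>\<^sup>2 * l / 2 * \<tau>\<^sup>2 < \<tau>"
          by (rule order_tendstoD) (simp add: \<tau>_def \<open>e > 0\<close>)
        then have "\<forall>\<^sub>F \<eta> in at_right 0. \<eta> > 0 \<and>
            g i \<bullet> d + s \<eta> * l / 2 * (norm d)\<^sup>2 + s \<eta> * \<eta>\<^sup>2 * l / 2 * \<tau>\<^sup>2 < \<tau>"
          using eventually_at_right_less[of "0::real"] by eventually_elim simp
        then obtain \<eta> where \<eta>: "\<eta> > 0"
            "g i \<bullet> d + s \<eta> * l / 2 * (norm d)\<^sup>2 + s \<eta> * \<eta>\<^sup>2 * l / 2 * \<tau>\<^sup>2 \<le> \<tau>"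
          using eventually_happens'[OF trivial_limit_at_right_real] by force
        define z where "z = (x i /\<^sub>R \<eta>, f i)"
        define n where "n = (\<eta> *\<^sub>R g i, -1::real) /\<^sub>R s \<eta>"
        define r where "r = 1 / (\<eta>\<^sup>2 * l)"
        obtain C where C: "C \<in> smooth_set_class (ereal (\<eta>\<^sup>2) * L)"
          "z \<in> frontier C" "(\<eta> *\<^sub>R g i, -1) \<in> normal_cone C z"
          "(\<eta> *\<^sub>R g j, -1) \<in> normal_cone C (x j /\<^sub>R \<eta>, f j)"
          using sets[OF \<eta>(1)] ij unfolding set_interpolable_def z_def by fastforce
        have s: "s \<eta> = norm (\<eta> *\<^sub>R g i, -1::real)"
          by (simp add: s_def norm_prod_def power_mult_distrib add.commute)
        then have "s \<eta> > 0"
          by (simp add: zero_prod_def)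
        have "n \<in> normal_cone C z"
          using C(3) \<open>s \<eta> > 0\<close> unfolding normal_cone_def n_def
          by (auto simp: mult_nonneg_nonpos simp del: scaleR_Pair)
        moreover have "norm n = 1"
          using \<open>s \<eta> > 0\<close> s by (simp add: n_def del: scaleR_Pair)
        moreover have "ereal (\<eta>\<^sup>2) * L \<noteq> 0"
          using \<eta>(1) \<open>l > 0\<close> by (simp add: real)
        moreover have "real_of_ereal (1 / (ereal (\<eta>\<^sup>2) * L)) = r"
          using \<eta>(1) \<open>l > 0\<close> by (simp add: real r_def one_ereal_def)
        ultimately have "cball (z - r *\<^sub>R n) r \<subseteq> C"
          using C(1,2) unfolding smooth_set_class_def smooth_set_def by (auto simp: Let_def)
        moreover have "((x i + d) /\<^sub>R \<eta>, f i + \<tau>) \<in> cball (z - r *\<^sub>R n) r"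
          unfolding z_def n_def
          by (rule ball_contains_near_paraboloid[OF \<eta>(1) \<open>l > 0\<close> _ r_def \<eta>(2)])
            (simp add: s_def)
        ultimately have "(u /\<^sub>R \<eta>, f i + \<tau>) \<in> C"
          by (auto simp: d_def)
        from below[OF \<eta>(1) this C(4)] show ?thesis
          by (simp add: \<tau>_def)
      qed
      then have "f j + g j \<bullet> (u - x j) \<le> f i + g i \<bullet> d + l / 2 * (norm d)\<^sup>2"
        by (rule field_le_epsilon)
      then show ?thesis
        by (simp add: real d_def ereal_half)
    qed
  qed (use assms in auto)
qed

section \<open>From functions to smooth sets\<close>

definition scaled_epi :: "real \<Rightarrow> ('a::euclidean_space \<Rightarrow> ereal) \<Rightarrow> ('a \<times> real) set" where
  "scaled_epi \<eta> F = {(y, t). F (\<eta> *\<^sub>R y) \<le> ereal t}"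

lemma closed_convex_scaled_epi:
  assumes "closed_convex_fun F"
  shows "closed (scaled_epi \<eta> F)" "convex (scaled_epi \<eta> F)"
proof -
  have vimage: "scaled_epi \<eta> F = (\<lambda>z. (\<eta> *\<^sub>R fst z, snd z)) -` epi F"
    by (auto simp: scaled_epi_def epi_def)
  have "closed (epi F)" "convex (epi F)"
    using assms by (auto simp: closed_convex_fun_def)
  then show "closed (scaled_epi \<eta> F)"
    unfolding vimage by (intro closed_vimage continuous_intros)
  have "linear (\<lambda>z :: 'a \<times> real. (\<eta> *\<^sub>R fst z, snd z))"
    by (rule linearI) (auto simp: scaleR_add_right)
  then show "convex (scaled_epi \<eta> F)"
    unfolding vimage using \<open>convex (epi F)\<close> by (rule convex_linear_vimage)
qed

lemma normal_cone_scaled_epi: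
  fixes F :: "'a::euclidean_space \<Rightarrow> ereal"
  assumes "\<eta> > 0" "g \<in> subdiff F p" "F p = ereal c"
  shows "(\<eta> *\<^sub>R g, -1) \<in> normal_cone (scaled_epi \<eta> F) (p /\<^sub>R \<eta>, c)"
  unfolding normal_cone_def
proof clarify
  fix y t assume "(y, t) \<in> scaled_epi \<eta> F"
  then have "F (\<eta> *\<^sub>R y) \<le> ereal t"
    by (simp add: scaled_epi_def)
  moreover have "ereal (c + g \<bullet> (\<eta> *\<^sub>R y - p)) \<le> F (\<eta> *\<^sub>R y)"
    using assms(2,3) unfolding subdiff_def by auto
  ultimately have "ereal (c + g \<bullet> (\<eta> *\<^sub>R y - p)) \<le> ereal t"
    by (rule order_trans[rotated])
  then show "(\<eta> *\<^sub>R g, -1) \<bullet> ((y, t) - (p /\<^sub>R \<eta>, c)) \<le> 0"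
    using \<open>\<eta> > 0\<close> by (simp add: inner_prod_def inner_diff_right inverse_eq_divide algebra_simps)
qed

lemma frontier_if_nonzero_normal:
  assumes "z \<in> C" "v \<in> normal_cone C z" "v \<noteq> 0"
  shows "z \<in> frontier C"
proof -
  have "z \<notin> interior C"
  proof
    assume "z \<in> interior C"
    then obtain e where e: "e > 0" "cball z e \<subseteq> C"
      by (auto simp: mem_interior_cball)
    have "z + (e / norm v) *\<^sub>R v \<in> cball z e"
      using e \<open>v \<noteq> 0\<close> by (simp add: dist_norm)
    then have "v \<bullet> ((e / norm v) *\<^sub>R v) \<le> 0"
      using assms(2) e(2) unfolding normal_cone_def by fastforce
    then have "v \<bullet> v \<le> 0"
      using e(1) \<open>v \<noteq> 0\<close> by (simp add: divide_le_0_iff mult_le_0_iff)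
    then show False
      using \<open>v \<noteq> 0\<close> by (metis inner_gt_zero_iff not_less)
  qed
  then show ?thesis
    using assms(1) closure_subset by (auto simp: frontier_def)
qed

text \<open>
  A finite function is defined in all horizontal directions, hence a nonzero normal of its epigraph cannot
  be horizontal; and a normal that is not horizontal can only be attached to a point of the graph.
\<close>

lemma normal_of_finite_scaled_epi:
  fixes F :: "'a::euclidean_space \<Rightarrow> ereal"
  assumes "\<eta> > 0" and fin: "\<And>u. F u = ereal (\<phi> u)"
    and z: "(y, t) \<in> scaled_epi \<eta> F"
    and normal: "(q, -s) \<in> normal_cone (scaled_epi \<eta> F) (y, t)" and "(q, s) \<noteq> 0"
  shows "s > 0" "t = \<phi> (\<eta> *\<^sub>R y)" "q /\<^sub>R (s * \<eta>) \<in> subdiff F (\<eta> *\<^sub>R y)"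
proof -
  have le: "q \<bullet> (y' - y) \<le> s * (t' - t)" if "\<phi> (\<eta> *\<^sub>R y') \<le> t'" for y' t'
  proof -
    have "(y', t') \<in> scaled_epi \<eta> F"
      using that by (simp add: scaled_epi_def fin)
    then have "(q, -s) \<bullet> ((y', t') - (y, t)) \<le> 0"
      using normal unfolding normal_cone_def by blast
    then show ?thesis
      by (simp add: inner_prod_def)
  qed
  have t: "\<phi> (\<eta> *\<^sub>R y) \<le> t"
    using z by (simp add: scaled_epi_def fin)
  have "s \<ge> 0"
    using le[of y "t + 1"] t by simp
  moreover have "s \<noteq> 0"
  proof
    assume "s = 0"
    then have "q \<bullet> q \<le> 0"
      using le[of "y + q" "\<phi> (\<eta> *\<^sub>R (y + q))"] by simp
    then show False
      using \<open>(q, s) \<noteq> 0\<close> \<open>s = 0\<close> by (metis inner_gt_zero_iff not_less zero_prod_def)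
  qed
  ultimately show "s > 0"
    by simp
  have "0 \<le> s * (\<phi> (\<eta> *\<^sub>R y) - t)"
    using le[of y "\<phi> (\<eta> *\<^sub>R y)"] by simp
  then show teq: "t = \<phi> (\<eta> *\<^sub>R y)"
    using t \<open>s > 0\<close> by (simp add: zero_le_mult_iff)
  have "\<phi> (\<eta> *\<^sub>R y) + (q /\<^sub>R (s * \<eta>)) \<bullet> (u - \<eta> *\<^sub>R y) \<le> \<phi> u" for u
  proof -
    have "q \<bullet> (u /\<^sub>R \<eta> - y) \<le> s * (\<phi> u - t)"
      using le[of "u /\<^sub>R \<eta>" "\<phi> u"] \<open>\<eta> > 0\<close> by simp
    then show ?thesis
      using \<open>\<eta> > 0\<close> \<open>s > 0\<close> teq by (simp add: inner_simps field_simps)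
  qed
  then show "q /\<^sub>R (s * \<eta>) \<in> subdiff F (\<eta> *\<^sub>R y)"
    unfolding subdiff_def by (simp add: fin)
qed

text \<open>
  Let \<open>(q, -s)\<close> be the unit normal. Relative to the tangent point, a point \<open>(e, \<tau>)\<close> of the
  ball satisfies \<open>s \<tau> \<ge> q \<bullet> e + |e|\<^sup>2 / (2 r)\<close>. Since \<open>s \<le> 1\<close>, dividing by \<open>s\<close>
  puts it above the paraboloid with slope \<open>q / s\<close> and curvature \<open>1 / r\<close>, which is the bound
  that smoothness gives for \<open>F\<close>.
\<close>

lemma scaled_epi_contains_ball:
  fixes F :: "'a::euclidean_space \<Rightarrow> ereal"
  assumes "\<eta> > 0" "l > 0" and fin: "\<And>u. F u = ereal (\<phi> u)"
    and smooth: "smooth_fun (ereal l) F"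
    and z: "z \<in> scaled_epi \<eta> F" and n: "n \<in> normal_cone (scaled_epi \<eta> F) z" "norm n = 1"
    and r: "r = 1 / (\<eta>\<^sup>2 * l)"
  shows "cball (z - r *\<^sub>R n) r \<subseteq> scaled_epi \<eta> F"
proof
  fix w assume w: "w \<in> cball (z - r *\<^sub>R n) r"
  obtain y t where zyt: "z = (y, t)" by (cases z)
  define q where "q = fst n"
  define s where "s = - snd n"
  have nqs: "n = (q, -s)"
    by (simp add: q_def s_def)
  have qs: "q \<bullet> q + s\<^sup>2 = 1"
    using n(2) unfolding nqs norm_prod_def by (simp add: power2_norm_eq_inner)
  then have "(q, s) \<noteq> 0"
    by (auto simp: zero_prod_def)
  note N = normal_of_finite_scaled_epi[OF \<open>\<eta> > 0\<close> fin z[unfolded zyt] n(1)[unfolded zyt nqs] this]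
  have "s \<le> 1"
    using qs by (metis inner_ge_zero le_add_same_cancel2 power2_le_imp_le one_power2 zero_le_one)
  have "r > 0"
    using assms(1,2) by (simp add: r)
  obtain e \<tau> where w': "w = z + (e, \<tau>)"
    by (metis add.commute diff_add_cancel surj_pair)
  then have "e \<bullet> e + \<tau> * \<tau> + 2 * r * (q \<bullet> e - s * \<tau>) \<le> 0"
    using w mem_tangent_cball_iff[OF n(2), of r z "(e, \<tau>)"] \<open>r > 0\<close>
    by (simp add: nqs inner_prod_def)
  then have "e \<bullet> e + 2 * r * (q \<bullet> e - s * \<tau>) \<le> 0"
    using zero_le_square[of \<tau>] by linarith
  then have 1: "(e \<bullet> e) / (2 * r) + q \<bullet> e \<le> s * \<tau>"
    using \<open>r > 0\<close> by (simp add: field_simps)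
  have "s * ((e \<bullet> e) / (2 * r)) \<le> (e \<bullet> e) / (2 * r)"
    using \<open>s \<le> 1\<close> N(1) \<open>r > 0\<close> by (intro mult_left_le_one_le) auto
  with 1 have "s * ((e \<bullet> e) / (2 * r) + (q \<bullet> e) / s) \<le> s * \<tau>"
    using N(1) by (simp add: distrib_left)
  then have "(e \<bullet> e) / (2 * r) + (q \<bullet> e) / s \<le> \<tau>"
    using N(1) by simp
  moreover have "F (\<eta> *\<^sub>R (y + e)) \<le> F (\<eta> *\<^sub>R y)
      + ereal ((q /\<^sub>R (s * \<eta>)) \<bullet> (\<eta> *\<^sub>R (y + e) - \<eta> *\<^sub>R y))
      + ereal l / 2 * ereal ((norm (\<eta> *\<^sub>R (y + e) - \<eta> *\<^sub>R y))\<^sup>2)"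
    using smooth N(3) unfolding smooth_fun_def by blast
  then have "\<phi> (\<eta> *\<^sub>R (y + e)) \<le> t + (q \<bullet> e) / s + (e \<bullet> e) / (2 * r)"
    using \<open>\<eta> > 0\<close> \<open>l > 0\<close> N(1)
    by (simp add: fin N(2) r scaleR_add_right power_mult_distrib power2_norm_eq_inner
      inverse_eq_divide field_simps ereal_half)
  ultimately show "w \<in> scaled_epi \<eta> F"
    by (simp add: w' zyt scaled_epi_def fin)
qed

text \<open>
  For finite \<open>L\<close>, a single subgradient makes \<open>F\<close> finite everywhere, because smoothness then
  bounds it by a quadratic; for \<open>L = 0\<close> upper and lower bound coincide, so that \<open>F\<close> is affine
  and its epigraph a halfspace.
\<close>

lemma scaled_epi_in_smooth_set_class:
  fixes F :: "'a::euclidean_space \<Rightarrow> ereal"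
  assumes "0 \<le> L" "\<eta> > 0" and F: "F \<in> fun_class 0 L" and k: "k \<in> subdiff F p"
  shows "scaled_epi \<eta> F \<in> smooth_set_class (ereal (\<eta>\<^sup>2) * L)"
proof -
  let ?C = "scaled_epi \<eta> F"
  have cc: "closed_convex_fun F" and smooth: "smooth_fun L F"
    using F by (auto simp: fun_class_def)
  obtain c where c: "F p = ereal c"
    using k cc unfolding subdiff_def closed_convex_fun_def by (cases "F p") auto
  have closed: "closed ?C" "convex ?C"
    using closed_convex_scaled_epi[OF cc] by auto
  have "(p /\<^sub>R \<eta>, c) \<in> ?C"
    using \<open>\<eta> > 0\<close> by (simp add: scaled_epi_def c)
  moreover have "smooth_set (ereal (\<eta>\<^sup>2) * L) ?C"
  proof (cases L)
    case PInf
    then have "ereal (\<eta>\<^sup>2) * L = \<infinity>"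
      using \<open>\<eta> > 0\<close> by simp
    then show ?thesis
      using closed(1) by (auto simp: smooth_set_def Let_def frontier_def)
  next
    case (real l)
    have upper: "F u \<le> ereal (c + k \<bullet> (u - p) + l / 2 * (norm (u - p))\<^sup>2)" for u
      using smooth k c unfolding smooth_fun_def real by (force simp: ereal_half)
    have lower: "ereal (c + k \<bullet> (u - p)) \<le> F u" for u
      using k c unfolding subdiff_def by auto
    show ?thesis
    proof (cases "l = 0")
      case True
      have "F u = ereal (c + k \<bullet> (u - p))" for u
        using upper[of u] lower[of u] True by (intro antisym) auto
      then have "?C = {z. (\<eta> *\<^sub>R k, -1) \<bullet> z \<le> k \<bullet> p - c}"
        unfolding scaled_epi_def by (auto simp: inner_prod_def inner_diff_right)
      then have "is_halfspace ?C"
        unfolding is_halfspace_def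
        by (intro exI[of _ "(\<eta> *\<^sub>R k, -1)"] exI[of _ "k \<bullet> p - c"]) (simp add: zero_prod_def)
      then show ?thesis
        by (simp add: smooth_set_def real True flip: zero_ereal_def)
    next
      case False
      then have "l > 0"
        using assms(1) real by simp
      define \<phi> where "\<phi> u = real_of_ereal (F u)" for u
      have fin: "F u = ereal (\<phi> u)" for u
        using upper[of u] lower[of u] unfolding \<phi>_def by (cases "F u") auto
      have "real_of_ereal (1 / (ereal (\<eta>\<^sup>2) * L)) = 1 / (\<eta>\<^sup>2 * l)"
        using \<open>\<eta> > 0\<close> \<open>l > 0\<close> by (simp add: real one_ereal_def)
      moreover have "ereal (\<eta>\<^sup>2) * L \<noteq> 0"
        using \<open>\<eta> > 0\<close> \<open>l > 0\<close> by (simp add: real)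
      moreover have "cball (z - (1 / (\<eta>\<^sup>2 * l)) *\<^sub>R n) (1 / (\<eta>\<^sup>2 * l)) \<subseteq> ?C"
        if "z \<in> frontier ?C" "n \<in> normal_cone ?C z" "norm n = 1" for z n
        using that smooth frontier_subset_closed[OF closed(1)] unfolding real
        by (intro scaled_epi_contains_ball[OF \<open>\<eta> > 0\<close> \<open>l > 0\<close> fin]) auto
      ultimately show ?thesis
        unfolding smooth_set_def by (simp add: Let_def)
    qed
  qed (use assms in auto)
  ultimately show ?thesis
    using closed unfolding smooth_set_class_def by auto
qed

lemma set_interpolable_if_fun_interpolable:
  fixes x g :: "'i \<Rightarrow> 'a::euclidean_space"
  assumes "0 \<le> L" "\<eta> > 0" and "I \<noteq> {}" and "fun_interpolable 0 L I (\<lambda>i. (x i, g i, f i))"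
  shows "set_interpolable (ereal (\<eta>\<^sup>2) * L) I (\<lambda>i. ((x i /\<^sub>R \<eta>, f i), (\<eta> *\<^sub>R g i, -1)))"
proof -
  obtain F where F: "F \<in> fun_class 0 L"
    and data: "\<And>i. i \<in> I \<Longrightarrow> g i \<in> subdiff F (x i) \<and> F (x i) = ereal (f i)"
    using assms(4) unfolding fun_interpolable_def by auto
  obtain i0 where "i0 \<in> I"
    using \<open>I \<noteq> {}\<close> by auto
  have "scaled_epi \<eta> F \<in> smooth_set_class (ereal (\<eta>\<^sup>2) * L)"
    using scaled_epi_in_smooth_set_class[OF assms(1,2) F] data[OF \<open>i0 \<in> I\<close>] by blast
  moreover have "(x i /\<^sub>R \<eta>, f i) \<in> scaled_epi \<eta> F \<and> (x i /\<^sub>R \<eta>, f i) \<in> frontier (scaled_epi \<eta> F) \<and>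
      (\<eta> *\<^sub>R g i, -1) \<in> normal_cone (scaled_epi \<eta> F) (x i /\<^sub>R \<eta>, f i)" if "i \<in> I" for i
  proof -
    have "(x i /\<^sub>R \<eta>, f i) \<in> scaled_epi \<eta> F"
      using data[OF that] \<open>\<eta> > 0\<close> by (simp add: scaled_epi_def)
    moreover have normal: "(\<eta> *\<^sub>R g i, -1) \<in> normal_cone (scaled_epi \<eta> F) (x i /\<^sub>R \<eta>, f i)"
      using data[OF that] by (intro normal_cone_scaled_epi[OF \<open>\<eta> > 0\<close>]) auto
    ultimately show ?thesis
      using frontier_if_nonzero_normal[OF _ normal] by (auto simp: zero_prod_def)
  qed
  ultimately show ?thesis
    unfolding set_interpolable_def by (intro bexI[of _ "scaled_epi \<eta> F"]) auto
qed

text \<open>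
  This settles empty \<open>I\<close>, where the interpolating function may have no subgradient at all and its
  epigraph may be empty.
\<close>

lemma smooth_set_class_nonempty:
  "\<exists>C :: ('a::euclidean_space \<times> real) set. C \<in> smooth_set_class \<beta>"
proof (cases "\<beta> = 0")
  case True
  let ?C = "{z :: 'a \<times> real. (0, 1) \<bullet> z \<le> 0}"
  have "is_halfspace ?C"
    unfolding is_halfspace_def by (intro exI[of _ "(0, 1)"] exI[of _ 0]) (simp add: zero_prod_def)
  moreover have "0 \<in> ?C"
    by simp
  ultimately have "?C \<in> smooth_set_class \<beta>"
    unfolding smooth_set_class_def smooth_set_def
    using True by (auto intro: closed_halfspace_le convex_halfspace_le simp del: inner_Pair_0)
  then show ?thesis by blast
next
  case False
  then have "UNIV \<in> smooth_set_class \<beta>"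
    unfolding smooth_set_class_def smooth_set_def by simp
  then show ?thesis by blast
qed

theorem theorem3p7:
  fixes I :: "'i set"
    and x g :: "'i \<Rightarrow> 'a::euclidean_space"
    and f :: "'i \<Rightarrow> real"
    and L :: ereal
  assumes "0 \<le> L"
  shows "fun_interpolable 0 L I (\<lambda>i. (x i, g i, f i)) \<longleftrightarrow>
    (\<forall>\<eta>::real. \<eta> > 0 \<longrightarrow>
      set_interpolable (ereal (\<eta>\<^sup>2) * L) I
        (\<lambda>i. ((x i /\<^sub>R \<eta>, f i), (\<eta> *\<^sub>R g i, -1))))"
proof (intro iffI allI impI)
  fix \<eta> :: real
  assume "fun_interpolable 0 L I (\<lambda>i. (x i, g i, f i))" "\<eta> > 0"
  then show "set_interpolable (ereal (\<eta>\<^sup>2) * L) I (\<lambda>i. ((x i /\<^sub>R \<eta>, f i), (\<eta> *\<^sub>R g i, -1)))"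
  proof (cases "I = {}")
    case True
    then show ?thesis
      using smooth_set_class_nonempty unfolding set_interpolable_def by auto
  qed (use assms in \<open>auto intro: set_interpolable_if_fun_interpolable\<close>)
next
  assume "\<forall>\<eta>::real. \<eta> > 0 \<longrightarrow> set_interpolable (ereal (\<eta>\<^sup>2) * L) I
    (\<lambda>i. ((x i /\<^sub>R \<eta>, f i), (\<eta> *\<^sub>R g i, -1)))"
  then show "fun_interpolable 0 L I (\<lambda>i. (x i, g i, f i))"
    by (intro fun_interpolableI[OF assms] tangents_below_paraboloids[OF assms]) auto
qed

end
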